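(* Suppose that $f(z)=h(z)\overline{g(z)}$ is a (non-vanishing) sense-preserving log-harmonic mapping in $\mathbb{D}$. Then the pre-Schwarzian derivative $P_f$ of $f$ is harmonic in $\mathbb{D}$ if and only if the dilatation $\mu$ of $f$ is constant.
   Context: $\mathbb{D}=\{z\in\mathbb{C}:|z|<1\}$. A non-vanishing log-harmonic mapping on $\mathbb{D}$ has the form $f=h\overline{g}$ with $h,g$ analytic and non-vanishing in $\mathbb{D}$, satisfying $\overline{f_{\overline z}}/\overline{f}=\mu\, f_z/f$ for an analytic $\mu:\mathbb{D}\to\mathbb{C}$ with $|\mu|<1$, the dilatation of $f$; thus $\mu(z)=\dfrac{g'(z)/g(z)}{h'(z)/h(z)}$. Put $$J_f(z)=\left|\frac{h'(z)}{h(z)}\right|^2\left(1-|\mu(z)|^2\right).$$ Sense-preserving means $J_f>0$ in $\mathbb{D}$, so $h'\neq0$ in $\mathbb{D}$. The pre-Schwarzian derivative of $f$ is $$P_f(z)=\left(\log J_f\right)_z=\left(\frac{h''(z)}{h'(z)}-\frac{h'(z)}{h(z)}\right)-\frac{\overline{\mu(z)}\,\mu'(z)}{1-|\mu(z)|^2}.$$ A complex-valued $C^2$ function $F$ is harmonic in $\mathbb{D}$ if $\Delta F=4\,\partial^2F/\partial z\,\partial\overline z=0$ in $\mathbb{D}$. *)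

theory Defs
  imports "HOL-Complex_Analysis.Complex_Analysis"
begin

definition dx :: "(complex \<Rightarrow> complex) \<Rightarrow> complex \<Rightarrow> complex" where
  "dx F z = frechet_derivative F (at z) 1"

definition dy :: "(complex \<Rightarrow> complex) \<Rightarrow> complex \<Rightarrow> complex" where
  "dy F z = frechet_derivative F (at z) \<i>"

text \<open>The Wirtinger derivatives. Here \<^emph>\<open>differentiable\<close> always means real differentiable; the values
  of \<open>dx\<close>, \<open>dy\<close>, \<open>dz\<close> and \<open>dzbar\<close> are meaningful only at points of differentiability.\<close>

definition dz :: "(complex \<Rightarrow> complex) \<Rightarrow> complex \<Rightarrow> complex" where
  "dz F z = (dx F z - \<i> * dy F z) / 2"

definition dzbar :: "(complex \<Rightarrow> complex) \<Rightarrow> complex \<Rightarrow> complex" where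
  "dzbar F z = (dx F z + \<i> * dy F z) / 2"

text \<open>\<open>C1_on\<close> and \<open>C2_on\<close> are intended for open sets.\<close>

definition C1_on :: "complex set \<Rightarrow> (complex \<Rightarrow> complex) \<Rightarrow> bool" where
  "C1_on S F \<longleftrightarrow> (\<forall>z\<in>S. F differentiable (at z)) \<and> continuous_on S (dx F) \<and> continuous_on S (dy F)"

definition C2_on :: "complex set \<Rightarrow> (complex \<Rightarrow> complex) \<Rightarrow> bool" where
  "C2_on S F \<longleftrightarrow> C1_on S F \<and> C1_on S (dx F) \<and> C1_on S (dy F)"

definition laplacian :: "(complex \<Rightarrow> complex) \<Rightarrow> complex \<Rightarrow> complex" where
  "laplacian F z = 4 * dz (dzbar F) z"

definition harmonic_on :: "complex set \<Rightarrow> (complex \<Rightarrow> complex) \<Rightarrow> bool" where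
  "harmonic_on S F \<longleftrightarrow> C2_on S F \<and> (\<forall>z\<in>S. laplacian F z = 0)"

abbreviation unit_disk :: "complex set" where
  "unit_disk \<equiv> ball 0 1"

text \<open>\<open>f\<close> is a non-vanishing log-harmonic mapping on the unit disk with analytic and co-analytic
  factors \<open>h\<close>, \<open>g\<close> and dilatation \<open>\<mu>\<close>.\<close>

definition log_harmonic ::
  "(complex \<Rightarrow> complex) \<Rightarrow> (complex \<Rightarrow> complex) \<Rightarrow> (complex \<Rightarrow> complex) \<Rightarrow> (complex \<Rightarrow> complex) \<Rightarrow> bool" where
  "log_harmonic f h g \<mu> \<longleftrightarrow>
     h holomorphic_on unit_disk \<and> g holomorphic_on unit_disk \<and>
     (\<forall>z\<in>unit_disk. h z \<noteq> 0 \<and> g z \<noteq> 0 \<and> f z = h z * cnj (g z)) \<and>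
     \<mu> holomorphic_on unit_disk \<and>
     (\<forall>z\<in>unit_disk. cmod (\<mu> z) < 1 \<and> cnj (dzbar f z) / cnj (f z) = \<mu> z * (dz f z / f z))"

definition log_jacobian :: "(complex \<Rightarrow> complex) \<Rightarrow> (complex \<Rightarrow> complex) \<Rightarrow> complex \<Rightarrow> real" where
  "log_jacobian h \<mu> z = (cmod (deriv h z / h z))\<^sup>2 * (1 - (cmod (\<mu> z))\<^sup>2)"

definition sense_preserving :: "(complex \<Rightarrow> complex) \<Rightarrow> (complex \<Rightarrow> complex) \<Rightarrow> bool" where
  "sense_preserving h \<mu> \<longleftrightarrow> (\<forall>z\<in>unit_disk. log_jacobian h \<mu> z > 0)"

text \<open>\<open>log_jacobian h \<mu>\<close> and \<open>pre_schwarzian h \<mu>\<close> depend only on \<open>f\<close>, since \<open>f\<close> determines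
  \<open>h\<close> up to a constant factor and, when \<open>h\<close> is non-constant, also \<open>\<mu>\<close>.\<close>

definition pre_schwarzian :: "(complex \<Rightarrow> complex) \<Rightarrow> (complex \<Rightarrow> complex) \<Rightarrow> complex \<Rightarrow> complex" where
  "pre_schwarzian h \<mu> = dz (\<lambda>z. complex_of_real (ln (log_jacobian h \<mu> z)))"

lemma pre_schwarzian_eq:
  assumes lh: "log_harmonic f h g \<mu>" and sp: "sense_preserving h \<mu>" and z: "z \<in> unit_disk"
  shows "pre_schwarzian h \<mu> z =
    deriv (deriv h) z / deriv h z - deriv h z / h z
      - cnj (\<mu> z) * deriv \<mu> z / of_real (1 - (cmod (\<mu> z))\<^sup>2)"
proof -
  define q where "q = (\<lambda>z. deriv h z / h z)"
  have hol: "h holomorphic_on unit_disk" "\<mu> holomorphic_on unit_disk" and h0: "h z \<noteq> 0"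
    and mu1: "cmod (\<mu> z) < 1"
    using lh z by (auto simp: log_harmonic_def)
  have J0: "log_jacobian h \<mu> z > 0" using sp z by (auto simp: sense_preserving_def)
  have q0: "q z \<noteq> 0" using J0 by (auto simp: log_jacobian_def q_def)
  hence h'0: "deriv h z \<noteq> 0" by (auto simp: q_def)
  have m0: "1 - (cmod (\<mu> z))\<^sup>2 > 0" using mu1 by (simp add: abs_square_less_1)
  have dh: "(h has_field_derivative deriv h z) (at z)"
    using hol z by (meson holomorphic_derivI open_ball)
  have dh': "(deriv h has_field_derivative deriv (deriv h) z) (at z)"
    using hol z by (meson holomorphic_derivI holomorphic_deriv open_ball)
  define q' where "q' = (deriv (deriv h) z * h z - deriv h z * deriv h z) / (h z * h z)"
  have dq: "(q has_derivative (*) q') (at z)"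
    unfolding q_def q'_def using DERIV_divide[OF dh' dh h0] by (simp add: has_field_derivative_def)
  have dm: "(\<mu> has_derivative (*) (deriv \<mu> z)) (at z)"
    using hol z by (metis has_field_derivative_def holomorphic_derivI open_ball)
  have J_eq: "log_jacobian h \<mu> = (\<lambda>w. (q w \<bullet> q w) * (1 - \<mu> w \<bullet> \<mu> w))"
    by (auto simp: log_jacobian_def q_def power2_norm_eq_inner)
  define L where "L = (\<lambda>v. complex_of_real
     (((q z \<bullet> q z) * (- (2 * (\<mu> z \<bullet> (deriv \<mu> z * v)))) + 2 * (q z \<bullet> (q' * v)) * (1 - \<mu> z \<bullet> \<mu> z))
       / log_jacobian h \<mu> z))"
  have dJ: "((\<lambda>w. complex_of_real (ln (log_jacobian h \<mu> w))) has_derivative L) (at z)"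
    using J0 unfolding J_eq L_def
    by (auto intro!: derivative_eq_intros dq dm simp: inner_commute field_simps)
  have fr: "frechet_derivative (\<lambda>w. complex_of_real (ln (log_jacobian h \<mu> w))) (at z) = L"
    using dJ frechet_derivative_at by metis
  have in_eq: "complex_of_real (a \<bullet> (b * 1)) - \<i> * complex_of_real (a \<bullet> (b * \<i>)) = cnj a * b" for a b
    by (simp add: complex_eq_iff inner_complex_def algebra_simps)
  define Q where "Q = q z \<bullet> q z"
  define M where "M = 1 - \<mu> z \<bullet> \<mu> z"
  have QM: "Q > 0" "M > 0" "log_jacobian h \<mu> z = Q * M"
    using q0 m0 by (auto simp: Q_def M_def J_eq power2_norm_eq_inner)
  have L2: "L v = 2 * (of_real (q z \<bullet> (q' * v)) / of_real Q - of_real (\<mu> z \<bullet> (deriv \<mu> z * v)) / of_real M)" for v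
    unfolding L_def QM(3) Q_def[symmetric] M_def[symmetric] using QM by (simp add: field_simps)
  have "pre_schwarzian h \<mu> z = (L 1 - \<i> * L \<i>) / 2"
    by (simp add: pre_schwarzian_def dz_def dx_def dy_def fr)
  also have "\<dots> = (of_real (q z \<bullet> (q' * 1)) - \<i> * of_real (q z \<bullet> (q' * \<i>))) / of_real Q
      - (of_real (\<mu> z \<bullet> (deriv \<mu> z * 1)) - \<i> * of_real (\<mu> z \<bullet> (deriv \<mu> z * \<i>))) / of_real M"
    unfolding L2 by (simp add: diff_divide_distrib right_diff_distrib)
  also have "\<dots> = cnj (q z) * q' / of_real Q - cnj (\<mu> z) * deriv \<mu> z / of_real M"
    unfolding in_eq ..
  also have "complex_of_real Q = cnj (q z) * q z"
    unfolding Q_def by (simp add: complex_eq_iff inner_complex_def algebra_simps)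
  also have "cnj (q z) * q' / (cnj (q z) * q z) = q' / q z" using q0 by simp
  also have "q' / q z = deriv (deriv h) z / deriv h z - deriv h z / h z"
    using h0 h'0 by (simp add: q'_def q_def field_simps)
  also have "M = 1 - (cmod (\<mu> z))\<^sup>2" by (simp add: M_def power2_norm_eq_inner)
  finally show ?thesis .
qed

end

theory Submission
  imports Defs
begin

text \<open>
  The pre-Schwarzian is \<open>P = A - cnj \<mu> * \<mu>' / (1 - \<bar>\<mu>\<bar>\<^sup>2)\<close> with \<open>A = h''/h' - h'/h\<close> holomorphic, so
  only the second term contributes to the Laplacian. The \<open>zbar\<close>-derivative of \<open>P\<close> is minus the
  pullback under \<open>\<mu>\<close> of the hyperbolic area density: \<open>dzbar P = - \<bar>\<mu>'\<bar>\<^sup>2 / (1 - \<bar>\<mu>\<bar>\<^sup>2)\<^sup>2\<close>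
  (lemma \<open>dzbar_pre_schwarzian\<close>). Applying \<open>dz\<close> once more (lemma \<open>laplacian_pre_schwarzian\<close>), the
  Laplacian of \<open>P\<close> vanishes exactly where
  \<open>cnj \<mu>' * (\<mu>'' * (1 - \<bar>\<mu>\<bar>\<^sup>2) + 2 * \<mu>'\<^sup>2 * cnj \<mu>) = 0\<close>.

  Where \<open>\<mu>' \<noteq> 0\<close>, the second factor must vanish for harmonic \<open>P\<close>. It is affine in \<open>cnj \<mu>\<close> with holomorphic
  coefficients, so \<open>cnj \<mu> * (2 * \<mu>'\<^sup>2 - \<mu> * \<mu>'') = - \<mu>''\<close>. The bracket has no zero there: a zero would
  force \<open>\<mu>'' = 0\<close> and then \<open>\<mu>' = 0\<close>. Hence \<open>cnj \<mu>\<close> is a quotient of holomorphic functions on the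
  open set \<open>\<mu>' \<noteq> 0\<close>; but a function that is holomorphic together with its conjugate has zero
  derivative (lemma \<open>deriv_eq_0_if_cnj_differentiable\<close>). So the set is empty and \<open>\<mu>\<close> is constant.

  Conversely, for constant \<open>\<mu>\<close> the second term is zero and \<open>P = A\<close> is holomorphic, hence harmonic.
\<close>

section \<open>Wirtinger derivatives\<close>

text \<open>A real-linear map of the plane is uniquely of the form \<open>v \<mapsto> a v + b cnj v\<close>. With derivatives
  in this form the Wirtinger derivatives can be read off, and the product and quotient rules
  apply without separating real and imaginary parts.\<close>

lemma wirtinger_eqI:
  assumes "(F has_derivative (\<lambda>v. a * v + b * cnj v)) (at z)"
  shows "dz F z = a" and "dzbar F z = b"
proof -
  have fr: "frechet_derivative F (at z) = (\<lambda>v. a * v + b * cnj v)"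
    using frechet_derivative_at[OF assms] by simp
  show "dz F z = a" "dzbar F z = b"
    by (simp_all add: dz_def dzbar_def dx_def dy_def fr algebra_simps)
qed

lemma frechet_derivative_cong_open:
  assumes "open S" "z \<in> S" and eq: "\<And>w. w \<in> S \<Longrightarrow> F w = G w"
  shows "frechet_derivative F (at z) = frechet_derivative G (at z)"
proof -
  have "(F has_derivative D) (at z) \<longleftrightarrow> (G has_derivative D) (at z)" for D
    using has_derivative_transform_within_open[OF _ assms(1,2), of F D UNIV G]
      has_derivative_transform_within_open[OF _ assms(1,2), of G D UNIV F] eq by auto
  thus ?thesis by (simp add: frechet_derivative_def)
qed

lemma wirtinger_cong_open:
  assumes "open S" "z \<in> S" "\<And>w. w \<in> S \<Longrightarrow> F w = G w"
  shows "dz F z = dz G z" and "dzbar F z = dzbar G z"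
  using frechet_derivative_cong_open[OF assms]
  by (simp_all add: dz_def dzbar_def dx_def dy_def)

text \<open>By uniqueness, the real derivative of \<open>cnj f\<close> is complex-linear and conjugate-linear at once.\<close>

lemma deriv_eq_0_if_cnj_differentiable:
  assumes f: "f field_differentiable at z"
    and cf: "(\<lambda>w. cnj (f w)) field_differentiable at z"
  shows "deriv f z = 0"
proof -
  obtain c where "((\<lambda>w. cnj (f w)) has_field_derivative c) (at z)"
    using cf by (auto simp: field_differentiable_def)
  hence "((\<lambda>w. cnj (f w)) has_derivative (\<lambda>v. c * v + 0 * cnj v)) (at z)"
    by (simp add: has_field_derivative_def)
  moreover have "((\<lambda>w. cnj (f w)) has_derivative (\<lambda>v. 0 * v + cnj (deriv f z) * cnj v)) (at z)"
    using has_derivative_cnj[OF field_differentiable_derivI[OF f, unfolded has_field_derivative_def]]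
    by simp
  ultimately have "cnj (deriv f z) = 0"
    using wirtinger_eqI(2) by metis
  thus ?thesis by simp
qed

section \<open>Holomorphic functions are harmonic\<close>

lemma holomorphic_frechet_derivative:
  assumes "F holomorphic_on S" "open S" "z \<in> S"
  shows "F differentiable (at z)" "dx F z = deriv F z" "dy F z = \<i> * deriv F z" "dzbar F z = 0"
proof -
  have d: "(F has_derivative (*) (deriv F z)) (at z)"
    using holomorphic_derivI[OF assms] by (simp add: has_field_derivative_def)
  have fr: "frechet_derivative F (at z) = (*) (deriv F z)"
    using frechet_derivative_at[OF d] by simp
  show "F differentiable (at z)" using d by (rule differentiableI)
  show "dx F z = deriv F z" "dy F z = \<i> * deriv F z"
    by (simp_all add: dx_def dy_def fr)
  thus "dzbar F z = 0" by (simp add: dzbar_def)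
qed

lemma C1_on_holomorphic:
  assumes "F holomorphic_on S" "open S"
  shows "C1_on S F"
proof -
  have c: "continuous_on S (deriv F)"
    using assms by (intro holomorphic_on_imp_continuous_on holomorphic_deriv)
  have "continuous_on S (dx F)"
    using c holomorphic_frechet_derivative(2)[OF assms] by (subst continuous_on_cong) auto
  moreover have "continuous_on S (\<lambda>z. \<i> * deriv F z)"
    using c by (intro continuous_intros)
  hence "continuous_on S (dy F)"
    using holomorphic_frechet_derivative(3)[OF assms] by (subst continuous_on_cong) auto
  ultimately show ?thesis
    using holomorphic_frechet_derivative(1)[OF assms] by (auto simp: C1_on_def)
qed

lemma harmonic_on_holomorphic:
  assumes F: "F holomorphic_on S" and S: "open S"
  shows "harmonic_on S F"
proof -
  have "dx F holomorphic_on S"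
    using holomorphic_deriv[OF F S] holomorphic_frechet_derivative(2)[OF F S]
    by (metis holomorphic_transform)
  moreover have "(\<lambda>z. \<i> * deriv F z) holomorphic_on S"
    using F S by (intro holomorphic_intros)
  hence "dy F holomorphic_on S"
    by (rule holomorphic_transform) (simp add: holomorphic_frechet_derivative(3)[OF F S])
  ultimately have "C2_on S F"
    using F S by (simp add: C2_on_def C1_on_holomorphic)
  moreover have "laplacian F z = 0" if "z \<in> S" for z
  proof -
    have "dz (dzbar F) z = dz (\<lambda>_. 0) z"
      using S that holomorphic_frechet_derivative(4)[OF F S] by (rule wirtinger_cong_open(1))
    also have "\<dots> = 0" by (rule wirtinger_eqI(1)[where b = 0]) simp
    finally show ?thesis by (simp add: laplacian_def)
  qed
  ultimately show ?thesis by (simp add: harmonic_on_def)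
qed

section \<open>The Wirtinger derivatives of the pre-Schwarzian\<close>

text \<open>In this section \<open>1 - \<bar>\<mu>\<bar>\<^sup>2\<close> is written \<open>1 - \<mu> * cnj \<mu>\<close>, which makes the expressions rational in
  holomorphic functions and their conjugates, as \<open>wirtinger_eqI\<close> needs them.\<close>

lemma one_minus_norm_square:
  "complex_of_real (1 - (cmod w)\<^sup>2) = 1 - w * cnj w"
  by (simp only: of_real_diff of_real_1 complex_norm_square)

lemma one_minus_mult_cnj_neq_0:
  assumes "cmod w < 1"
  shows "1 - w * cnj w \<noteq> 0"
proof -
  have "(cmod w)\<^sup>2 < 1" using assms by (simp add: abs_square_less_1)
  hence "complex_of_real (1 - (cmod w)\<^sup>2) \<noteq> 0" by (metis of_real_eq_0_iff diff_gt_0_iff_gt less_irrefl)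
  thus ?thesis by (simp only: one_minus_norm_square not_False_eq_True)
qed

text \<open>The quotient rule gives the numerator \<open>\<bar>m\<bar>\<^sup>2 * ((1 - \<bar>\<mu>\<bar>\<^sup>2) + \<bar>\<mu>\<bar>\<^sup>2)\<close>, which collapses to \<open>\<bar>m\<bar>\<^sup>2\<close>;
  the summand \<open>A\<close>, being complex differentiable, drops out.\<close>

lemma dzbar_minus_hyperbolic_term:
  assumes A: "(A has_field_derivative A') (at z)"
    and m: "(\<mu> has_field_derivative m z) (at z)" and m': "(m has_field_derivative m') (at z)"
    and mu1: "cmod (\<mu> z) < 1"
  shows "dzbar (\<lambda>w. A w - cnj (\<mu> w) * m w / (1 - \<mu> w * cnj (\<mu> w))) z =
    - (m z * cnj (m z)) / (1 - \<mu> z * cnj (\<mu> z))\<^sup>2"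
proof -
  define D where "D = 1 - \<mu> z * cnj (\<mu> z)"
  have D0: "D \<noteq> 0" using one_minus_mult_cnj_neq_0[OF mu1] by (simp add: D_def)
  note d = A[unfolded has_field_derivative_def] m[unfolded has_field_derivative_def]
    m'[unfolded has_field_derivative_def]
  have q: "((\<lambda>w. A w - cnj (\<mu> w) * m w / (1 - \<mu> w * cnj (\<mu> w))) has_derivative
      (\<lambda>v. (A' - cnj (\<mu> z) * m' / D - (cnj (\<mu> z))\<^sup>2 * (m z)\<^sup>2 / D\<^sup>2) * v
            + (- (m z * cnj (m z)) / D\<^sup>2) * cnj v)) (at z)"
    apply (rule has_derivative_eq_rhs)
     apply (rule derivative_intros d D0[unfolded D_def] | simp add: D0[unfolded D_def, simplified])+
    apply (rule ext)
    \<comment> \<open>The denominator stays atomic until fractions are cleared. Only then is its value used, since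
      the collapse of the numerator depends on it.\<close>
    apply (unfold D_def[symmetric])
    using D0 apply (simp add: divide_simps)
    apply (simp add: D_def algebra_simps power2_eq_square)
    done
  show ?thesis using wirtinger_eqI(2)[OF q] by (simp add: D_def)
qed

lemma dz_hyperbolic_density:
  assumes m: "(\<mu> has_field_derivative m z) (at z)" and m': "(m has_field_derivative m') (at z)"
    and mu1: "cmod (\<mu> z) < 1"
  shows "dz (\<lambda>w. - (m w * cnj (m w)) / (1 - \<mu> w * cnj (\<mu> w))\<^sup>2) z =
    - (cnj (m z) * (m' * (1 - \<mu> z * cnj (\<mu> z)) + 2 * (m z)\<^sup>2 * cnj (\<mu> z)))
      / (1 - \<mu> z * cnj (\<mu> z)) ^ 3"
proof -
  define D where "D = 1 - \<mu> z * cnj (\<mu> z)"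
  have D0: "D \<noteq> 0" using one_minus_mult_cnj_neq_0[OF mu1] by (simp add: D_def)
  note d = m[unfolded has_field_derivative_def] m'[unfolded has_field_derivative_def]
  have q: "((\<lambda>w. - (m w * cnj (m w)) / (1 - \<mu> w * cnj (\<mu> w))\<^sup>2) has_derivative
      (\<lambda>v. (- (cnj (m z) * (m' * D + 2 * (m z)\<^sup>2 * cnj (\<mu> z))) / D ^ 3) * v
         + (- (m z * (cnj m' * D + 2 * (cnj (m z))\<^sup>2 * \<mu> z)) / D ^ 3) * cnj v)) (at z)"
    apply (rule has_derivative_eq_rhs)
     apply (rule derivative_intros d D0[unfolded D_def] | simp add: D0[unfolded D_def, simplified])+
    apply (rule ext)
    \<comment> \<open>An identity in the denominator as an indeterminate; expanding it would only raise degrees.\<close>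
    apply (unfold D_def[symmetric])
    using D0 apply (simp add: field_simps power2_eq_square power3_eq_cube)
    done
  show ?thesis using wirtinger_eqI(1)[OF q] by (simp add: D_def)
qed

section \<open>Harmonicity and the dilatation\<close>

context
  fixes f h g \<mu> :: "complex \<Rightarrow> complex"
  assumes lh: "log_harmonic f h g \<mu>" and sp: "sense_preserving h \<mu>"
begin

lemma dilatation_holomorphic: "\<mu> holomorphic_on unit_disk" "deriv \<mu> holomorphic_on unit_disk"
  using lh by (auto simp: log_harmonic_def intro: holomorphic_deriv)

lemma dilatation_less_1: "z \<in> unit_disk \<Longrightarrow> cmod (\<mu> z) < 1"
  using lh by (simp add: log_harmonic_def)

lemma analytic_part_holomorphic:
  "(\<lambda>z. deriv (deriv h) z / deriv h z - deriv h z / h z) holomorphic_on unit_disk"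
proof -
  have "h holomorphic_on unit_disk" and "\<And>z. z \<in> unit_disk \<Longrightarrow> h z \<noteq> 0"
    using lh by (auto simp: log_harmonic_def)
  moreover have "deriv h z \<noteq> 0" if "z \<in> unit_disk" for z
    using sp that by (force simp: sense_preserving_def log_jacobian_def)
  ultimately show ?thesis by (intro holomorphic_intros) auto
qed

lemma dzbar_pre_schwarzian:
  assumes z: "z \<in> unit_disk"
  shows "dzbar (pre_schwarzian h \<mu>) z =
    - (deriv \<mu> z * cnj (deriv \<mu> z)) / (1 - \<mu> z * cnj (\<mu> z))\<^sup>2"
proof -
  have "dzbar (pre_schwarzian h \<mu>) z =
      dzbar (\<lambda>w. (deriv (deriv h) w / deriv h w - deriv h w / h w)
        - cnj (\<mu> w) * deriv \<mu> w / (1 - \<mu> w * cnj (\<mu> w))) z"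
    using pre_schwarzian_eq[OF lh sp]
    by (intro wirtinger_cong_open(2)[OF open_ball z]) (simp only: one_minus_norm_square)
  also have "\<dots> = - (deriv \<mu> z * cnj (deriv \<mu> z)) / (1 - \<mu> z * cnj (\<mu> z))\<^sup>2"
    by (rule dzbar_minus_hyperbolic_term
        [OF holomorphic_derivI[OF analytic_part_holomorphic open_ball z]
            holomorphic_derivI[OF dilatation_holomorphic(1) open_ball z]
            holomorphic_derivI[OF dilatation_holomorphic(2) open_ball z] dilatation_less_1[OF z]])
  finally show ?thesis .
qed

lemma laplacian_pre_schwarzian:
  assumes z: "z \<in> unit_disk"
  shows "laplacian (pre_schwarzian h \<mu>) z =
    - 4 * (cnj (deriv \<mu> z) *
        (deriv (deriv \<mu>) z * (1 - \<mu> z * cnj (\<mu> z)) + 2 * (deriv \<mu> z)\<^sup>2 * cnj (\<mu> z)))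
      / (1 - \<mu> z * cnj (\<mu> z)) ^ 3"
proof -
  have "dz (dzbar (pre_schwarzian h \<mu>)) z =
      dz (\<lambda>w. - (deriv \<mu> w * cnj (deriv \<mu> w)) / (1 - \<mu> w * cnj (\<mu> w))\<^sup>2) z"
    by (rule wirtinger_cong_open(1)[OF open_ball z dzbar_pre_schwarzian])
  also note dz_hyperbolic_density
    [OF holomorphic_derivI[OF dilatation_holomorphic(1) open_ball z]
        holomorphic_derivI[OF dilatation_holomorphic(2) open_ball z] dilatation_less_1[OF z]]
  finally show ?thesis by (simp add: laplacian_def)
qed

text \<open>The vanishing Laplacian expresses \<open>cnj \<mu>\<close> through \<open>\<mu>\<close> and its derivatives, hence
  holomorphically, wherever \<open>\<mu>'\<close> does not vanish.\<close>

lemma deriv_dilatation_eq_0: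
  assumes harm: "harmonic_on unit_disk (pre_schwarzian h \<mu>)" and z: "z \<in> unit_disk"
  shows "deriv \<mu> z = 0"
proof (rule ccontr)
  assume nz: "deriv \<mu> z \<noteq> 0"
  define U where "U = {w \<in> unit_disk. deriv \<mu> w \<noteq> 0}"
  define a where "a = (\<lambda>w. 2 * (deriv \<mu> w)\<^sup>2 - \<mu> w * deriv (deriv \<mu>) w)"
  have U: "open U" "z \<in> U" "U \<subseteq> unit_disk"
  proof -
    have "continuous_on unit_disk (deriv \<mu>)"
      using dilatation_holomorphic(2) by (rule holomorphic_on_imp_continuous_on)
    hence "open (unit_disk \<inter> deriv \<mu> -` (- {0}))"
      by (rule continuous_open_preimage) auto
    moreover have "U = unit_disk \<inter> deriv \<mu> -` (- {0})" by (auto simp: U_def)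
    ultimately show "open U" by simp
  qed (use nz z in \<open>auto simp: U_def\<close>)
  \<comment> \<open>the equation of the vanishing Laplacian, solved for \<open>cnj \<mu>\<close>\<close>
  have eq: "cnj (\<mu> w) * a w = - deriv (deriv \<mu>) w" if "w \<in> U" for w
  proof -
    have w: "w \<in> unit_disk" "deriv \<mu> w \<noteq> 0" using that by (auto simp: U_def)
    have "laplacian (pre_schwarzian h \<mu>) w = 0"
      using harm w(1) by (simp add: harmonic_on_def)
    hence "deriv (deriv \<mu>) w * (1 - \<mu> w * cnj (\<mu> w)) + 2 * (deriv \<mu> w)\<^sup>2 * cnj (\<mu> w) = 0"
      using w(2) one_minus_mult_cnj_neq_0[OF dilatation_less_1[OF w(1)]]
      unfolding laplacian_pre_schwarzian[OF w(1)] by simp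
    thus ?thesis by (simp add: a_def algebra_simps eq_neg_iff_add_eq_0)
  qed
  have a0: "a w \<noteq> 0" if "w \<in> U" for w
  proof
    assume "a w = 0"
    moreover from this have "deriv (deriv \<mu>) w = 0" using eq[OF that] by simp
    ultimately show False using that by (simp add: a_def U_def)
  qed
  have "\<mu> holomorphic_on U" "deriv \<mu> holomorphic_on U"
    using dilatation_holomorphic U(3) by (auto intro: holomorphic_on_subset)
  hence "(\<lambda>w. - deriv (deriv \<mu>) w / a w) holomorphic_on U"
    using a0 U(1) unfolding a_def by (intro holomorphic_intros) auto
  hence "(\<lambda>w. cnj (\<mu> w)) holomorphic_on U"
    by (rule holomorphic_transform) (metis eq a0 nonzero_mult_div_cancel_right)
  hence "deriv \<mu> z = 0"
    using U \<open>\<mu> holomorphic_on U\<close>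
    by (intro deriv_eq_0_if_cnj_differentiable) (auto intro: holomorphic_on_imp_differentiable_at)
  with nz show False ..
qed

lemma harmonic_pre_schwarzian_imp_constant:
  assumes "harmonic_on unit_disk (pre_schwarzian h \<mu>)"
  shows "\<mu> constant_on unit_disk"
proof -
  have "(\<mu> has_field_derivative 0) (at z within unit_disk)" if "z \<in> unit_disk" for z
    using holomorphic_derivI[OF dilatation_holomorphic(1) open_ball that]
      deriv_dilatation_eq_0[OF assms that] by (metis has_field_derivative_at_within)
  hence "\<exists>c. \<forall>z\<in>unit_disk. \<mu> z = c"
    by (intro has_field_derivative_zero_constant convex_ball) auto
  thus ?thesis by (simp add: constant_on_def)
qed

lemma constant_imp_harmonic_pre_schwarzian:
  assumes "\<mu> constant_on unit_disk"
  shows "harmonic_on unit_disk (pre_schwarzian h \<mu>)"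
proof -
  obtain c where c: "\<And>z. z \<in> unit_disk \<Longrightarrow> \<mu> z = c"
    using assms by (auto simp: constant_on_def)
  have "deriv \<mu> z = 0" if z: "z \<in> unit_disk" for z
  proof -
    have "(\<mu> has_field_derivative 0) (at z)"
      by (rule has_field_derivative_transform_within_open[of "\<lambda>_. c", OF _ open_ball z])
        (auto simp: c)
    thus ?thesis by (rule DERIV_imp_deriv)
  qed
  hence "pre_schwarzian h \<mu> holomorphic_on unit_disk"
    using pre_schwarzian_eq[OF lh sp]
    by (intro holomorphic_transform[OF analytic_part_holomorphic]) simp
  thus ?thesis by (intro harmonic_on_holomorphic open_ball)
qed

end

theorem theorem5p1:
  fixes f h g \<mu> :: "complex \<Rightarrow> complex"
  assumes "log_harmonic f h g \<mu>"
    and "sense_preserving h \<mu>"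
  shows "harmonic_on unit_disk (pre_schwarzian h \<mu>) \<longleftrightarrow> \<mu> constant_on unit_disk"
  using harmonic_pre_schwarzian_imp_constant[OF assms] constant_imp_harmonic_pre_schwarzian[OF assms]
  by blast

end
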